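(* The optimal solution $\widetilde\pi^*=(\widetilde\tau^*,\widetilde\mu^*_0,\dots,\widetilde\mu^*_T)$ can be summarized by three disjoint regions for the incoming stock value for every decision epoch as well as order-up-to levels: (1) The ordering region $\{(k,x)\in\mathbb{T}\times\mathbb{Z}_+:x\in R^O_k\}$, the stopping region $\{(k,x)\in\mathbb{T}\times\mathbb{Z}_+:x\in R^S_k\}$, and the continuation region $\{(k,x)\in\mathbb{T}\times\mathbb{Z}_+:x\in R^C_k\}$ are disjoint subsets of $\mathbb{T}\times\mathbb{Z}_+$. (2) $\widetilde\pi^*$ is a policy such that if $X^{\widetilde\pi^*}_k\in R^S_k$, then we stop; if $X^{\widetilde\pi^*}_k\in R^C_k$, then we continue without taking an action; if $X^{\widetilde\pi^*}_k\in R^O_k$, then we place an order and increase inventory to an order-up-to level. Hence, for each inventory level in $R^O_k$, there exists an optimal order-up-to level.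
   Context: $T\in[0,\infty)$ is the time horizon, $\mathbb{T}=\{0,1,\dots,T\}$, $\mathbb{Z}_+=\{0,1,2,\dots\}$, $(a)^+=\max\{0,a\}$, $a\wedge b=\min\{a,b\}$. Demand is a non-homogeneous Poisson process $N=(N_t)_{t\in[0,T]}$ with intensity $\lambda:[0,T]\to\mathbb{R}_+$, which is right-continuous with left limits, piecewise smooth (differentiable except at finitely many points), and non-increasing. Constants: unit purchasing cost $\bar c\in\mathbb{R}_+$, fixed ordering cost $K\in\mathbb{R}_+$, holding cost rate $c_1\in\mathbb{R}_+$, scrapping cost $c_4\in\mathbb{R}$ with $\bar c>-c_4$, discount rate $\delta\in[0,1]$. Functions $c_2,c_3:[0,T]\to\mathbb{R}_+$ with $c_2\ge c_3$. Ordering cost: $c(m)=K+\bar c\,m$ for $m>0$ and $c(0)=0$. For $k\in\mathbb{T}$ and $x\in\mathbb{Z}_+$, let $\sigma^k_x:=\inf\{u>k:N_u-N_k\ge x\}$, $$\widetilde C(k,x)=c_1\mathbb{E}\Big[\int_k^{k+1}e^{-\delta(u-k)}(x-(N_u-N_k))^+du\Big]+\mathbb{E}\Big[\int_k^{k+1}e^{-\delta(u-k)}[c_2(u)-c_3(u)]\,dN_u\Big]-\mathbb{E}\Big[\int_k^{(k+1)\wedge\sigma^k_x}e^{-\delta(u-k)}c_2(u)\,dN_u\Big],$$ and $\widetilde S(x)=c_4x$. Problem: a policy $\pi=(\tau,\mu_0,\dots,\mu_T)$ consists of a stopping time $\tau$ with values in $\mathbb{T}$ of the filtration generated by $N$ and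 order functions $\mu_k:\mathbb{Z}_+\to\mathbb{Z}_+$; under $\pi$ the inventory evolves as $X^\pi_0=x$, $X^\pi_{k+1}=(X^\pi_k+\mu_k(X^\pi_k)-(N_{k+1}-N_k))^+$. The aim is to attain $$\widetilde V^*(x)=\inf_\pi\mathbb{E}\Big[\sum_{k=0}^{\tau-1}e^{-\delta k}\big(c(\mu_k(X^\pi_k))+\widetilde C(k,X^\pi_k+\mu_k(X^\pi_k))\big)+e^{-\delta\tau}\widetilde S(X^\pi_\tau)\,\Big|\,X^\pi_0=x\Big].$$ Dynamic programming recursion: $\widetilde V(T,x)=\widetilde S(x)$, and for $k=T-1,\dots,0$ and $x,y\in\mathbb{Z}_+$, $$\widetilde G(k,y)=\widetilde C(k,y)+e^{-\delta}\,\mathbb{E}\big[\widetilde V(k+1,(y-(N_{k+1}-N_k))^+)\big],\quad \widetilde J(k,x)=\inf_{m\in\mathbb{Z}_+}\big(c(m)+\widetilde G(k,x+m)\big),\quad \widetilde V(k,x)=\min\{\widetilde S(x),\widetilde J(k,x)\}.$$ The optimal policy $\widetilde\pi^*=(\widetilde\tau^*,\widetilde\mu^*_0,\dots,\widetilde\mu^*_T)$ is given by: the optimal order amount $\widetilde\mu^*_k(x)$ attains the infimum defining $\widetilde J(k,x)$, and $\widetilde\tau^*=\min\{k\in\mathbb{T}:\widetilde S(X^{\widetilde\pi^*}_k)\le\widetilde J(k,X^{\widetilde\pi^*}_k)\}$; one has $\widetilde V(0,x)=\widetilde V^*(x)$. Stopping, ordering and continuation sets: for $k\in\mathbb{T}$,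 $$R^S_k=\{x\in\mathbb{Z}_+:\widetilde S(x)\le\widetilde J(k,x)\},$$ $$R^O_k=\Big\{x\in\mathbb{Z}_+:\inf_{m\ge1}\big(c(m)+\widetilde G(k,x+m)\big)<\min\{\widetilde S(x),\widetilde G(k,x)\}\Big\},$$ $$R^C_k=\{x\in\mathbb{Z}_+:\widetilde V(k,x)=\widetilde G(k,x)<\widetilde S(x)\}.$$
   Formalization: The optimal order amount is taken to be 0 whenever not ordering also attains the infimum; without this tie-breaking rule a non-unique minimiser could order on the continuation region, and part (2) would fail. *)

theory Defs
  imports "HOL-Probability.Probability"
begin

text \<open>
  The Poisson law is written out because the library's Poisson distribution needs a strictly
  positive rate, whereas the integral of the intensity may vanish. Paths are non-decreasing, so the
  subtraction of natural numbers in the increments does not truncate.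
\<close>

definition history :: "'w measure \<Rightarrow> (real \<Rightarrow> 'w \<Rightarrow> nat) \<Rightarrow> real \<Rightarrow> real \<Rightarrow> 'w measure" where
  "history M N H t = sigma (space M) {N s -` A \<inter> space M | s A. 0 \<le> s \<and> s \<le> t \<and> s \<le> H}"

definition poisson_process ::
  "'w measure \<Rightarrow> real \<Rightarrow> (real \<Rightarrow> real) \<Rightarrow> (real \<Rightarrow> 'w \<Rightarrow> nat) \<Rightarrow> bool" where
  "poisson_process M H lam N \<longleftrightarrow>
     prob_space M \<and>
     (\<forall>t\<in>{0..H}. N t \<in> measurable M (count_space UNIV)) \<and>
     (\<forall>\<omega>\<in>space M. N 0 \<omega> = 0 \<and> mono_on {0..H} (\<lambda>t. N t \<omega>) \<and>
        (\<forall>t\<in>{0..<H}. continuous (at_right t) (\<lambda>s. real (N s \<omega>)))) \<and>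
     (\<forall>s t. 0 \<le> s \<and> s \<le> t \<and> t \<le> H \<longrightarrow>
        prob_space.indep_set M (sets (history M N H s))
          (sets (vimage_algebra (space M) (\<lambda>\<omega>. N t \<omega> - N s \<omega>) (count_space UNIV))) \<and>
        (\<forall>n. measure M {\<omega>\<in>space M. N t \<omega> - N s \<omega> = n} =
           (LINT u:{s..t}|lborel. lam u) ^ n / fact n * exp (- (LINT u:{s..t}|lborel. lam u))))"

definition intensity_function :: "real \<Rightarrow> (real \<Rightarrow> real) \<Rightarrow> bool" where
  "intensity_function H lam \<longleftrightarrow>
     (\<forall>t\<in>{0..H}. 0 \<le> lam t) \<and>
     (\<forall>t\<in>{0..<H}. continuous (at_right t) lam) \<and>
     (\<forall>t\<in>{0<..H}. \<exists>l. (lam \<longlongrightarrow> l) (at_left t)) \<and>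
     (\<exists>E. finite E \<and> (\<forall>t\<in>{0..H} - E. lam differentiable (at t within {0..H}))) \<and>
     antimono_on {0..H} lam"

text \<open>Time-dependent data are relevant only on the interval from 0 to the horizon.\<close>

record 'w inventory =
  prob_model :: "'w measure"
  demand :: "real \<Rightarrow> 'w \<Rightarrow> nat"
  intensity :: "real \<Rightarrow> real"
  horizon :: nat
  unit_cost :: real
  fixed_cost :: real
  holding_rate :: real
  cost2 :: "real \<Rightarrow> real"
  cost3 :: "real \<Rightarrow> real"
  scrap_cost :: real
  discount :: real

text \<open>
  The integral of \<open>f\<close> against \<open>dN\<close> over the half-open interval from \<open>a\<close> (excluded) to \<open>b\<close>
  (included) is the pathwise Lebesgue-Stieltjes integral. The path is extended by constants outside
  the time interval, since the measure needs a distribution function on the whole line.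
\<close>

definition dN_integral ::
  "'w inventory \<Rightarrow> (real \<Rightarrow> real) \<Rightarrow> real \<Rightarrow> ereal \<Rightarrow> 'w \<Rightarrow> real" where
  "dN_integral P f a b \<omega> =
     (LINT u:{u. a < u \<and> ereal u \<le> b}|
        interval_measure (\<lambda>u. real (demand P (max 0 (min (real (horizon P)) u)) \<omega>)). f u)"

text \<open>
  The last three conjuncts say that the expectations in the one-period cost below are meaningful:
  \<open>cost2\<close> and \<open>cost3\<close> are Borel and the expected integral of \<open>cost2\<close> against the demand process is
  finite (the same then holds for \<open>cost3\<close>).
\<close>

definition inventory_problem :: "'w inventory \<Rightarrow> bool" where
  "inventory_problem P \<longleftrightarrow>
     intensity_function (real (horizon P)) (intensity P) \<and>
     poisson_process (prob_model P) (real (horizon P)) (intensity P) (demand P) \<and>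
     0 \<le> unit_cost P \<and> 0 \<le> fixed_cost P \<and> 0 \<le> holding_rate P \<and>
     - scrap_cost P < unit_cost P \<and>
     0 \<le> discount P \<and> discount P \<le> 1 \<and>
     (\<forall>t\<in>{0..real (horizon P)}. 0 \<le> cost3 P t \<and> cost3 P t \<le> cost2 P t) \<and>
     set_borel_measurable borel {0..real (horizon P)} (cost2 P) \<and>
     set_borel_measurable borel {0..real (horizon P)} (cost3 P) \<and>
     integrable (prob_model P) (dN_integral P (cost2 P) 0 (ereal (real (horizon P))))"

definition order_cost :: "'w inventory \<Rightarrow> nat \<Rightarrow> real" where
  "order_cost P m = (if m = 0 then 0 else fixed_cost P + unit_cost P * real m)"

text \<open>Extended-real valued, so that the infimum of the empty set is infinite.\<close>

definition depletion_time :: "'w inventory \<Rightarrow> nat \<Rightarrow> nat \<Rightarrow> 'w \<Rightarrow> ereal" where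
  "depletion_time P k x \<omega> =
     Inf {ereal u | u. real k < u \<and> u \<le> real (horizon P) \<and>
        real (demand P u \<omega>) - real (demand P (real k) \<omega>) \<ge> real x}"

definition period_cost :: "'w inventory \<Rightarrow> nat \<Rightarrow> nat \<Rightarrow> real" where
  "period_cost P k x =
     holding_rate P *
       (\<integral>\<omega>. (LINT u:{real k..real (k + 1)}|lborel. exp (- discount P * (u - real k)) *
          max 0 (real x - (real (demand P u \<omega>) - real (demand P (real k) \<omega>)))) \<partial>prob_model P)
     + (\<integral>\<omega>. dN_integral P (\<lambda>u. exp (- discount P * (u - real k)) * (cost2 P u - cost3 P u))
          (real k) (ereal (real (k + 1))) \<omega> \<partial>prob_model P)
     - (\<integral>\<omega>. dN_integral P (\<lambda>u. exp (- discount P * (u - real k)) * cost2 P u)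
          (real k) (min (ereal (real (k + 1))) (depletion_time P k x \<omega>)) \<omega> \<partial>prob_model P)"

definition scrap_value :: "'w inventory \<Rightarrow> nat \<Rightarrow> real" where
  "scrap_value P x = scrap_cost P * real x"

text \<open>The coercion \<open>nat\<close> from the integers is the positive part.\<close>

definition leftover :: "'w inventory \<Rightarrow> nat \<Rightarrow> nat \<Rightarrow> 'w \<Rightarrow> nat" where
  "leftover P k y \<omega> =
     nat (int y - (int (demand P (real (k + 1)) \<omega>) - int (demand P (real k) \<omega>)))"

text \<open>
  \<open>dp_G\<close> and \<open>dp_J\<close> are meaningful only for epochs strictly before the horizon; nothing below uses
  them at the horizon.
\<close>

function dp_V :: "'w inventory \<Rightarrow> nat \<Rightarrow> nat \<Rightarrow> real"
  and dp_G :: "'w inventory \<Rightarrow> nat \<Rightarrow> nat \<Rightarrow> real"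
  and dp_J :: "'w inventory \<Rightarrow> nat \<Rightarrow> nat \<Rightarrow> real" where
  "dp_V P k x = (if k < horizon P then min (scrap_value P x) (dp_J P k x) else scrap_value P x)"
| "dp_G P k y =
     period_cost P k y +
       exp (- discount P) * (\<integral>\<omega>. dp_V P (k + 1) (leftover P k y \<omega>) \<partial>prob_model P)"
| "dp_J P k x = (INF m. order_cost P m + dp_G P k (x + m))"
  by pat_completeness auto
termination
  by (relation "Wellfounded.measure (\<lambda>z. case z of
        Inl (P, k, x) \<Rightarrow> if k < horizon P then 3 * (horizon P - k) + 3 else 0
      | Inr (Inl (P, k, y)) \<Rightarrow> 3 * (horizon P - k) + 1
      | Inr (Inr (P, k, x)) \<Rightarrow> 3 * (horizon P - k) + 2)") auto

declare dp_V.simps [simp del] dp_G.simps [simp del] dp_J.simps [simp del]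

text \<open>
  At the horizon the problem ends, which amounts to the convention that \<open>dp_G\<close> and \<open>dp_J\<close> are
  infinite there: every state is in the stopping set and the other two sets are empty.
\<close>

definition stopping_set :: "'w inventory \<Rightarrow> nat \<Rightarrow> nat set" where
  "stopping_set P k = {x. k < horizon P \<longrightarrow> scrap_value P x \<le> dp_J P k x}"

definition ordering_set :: "'w inventory \<Rightarrow> nat \<Rightarrow> nat set" where
  "ordering_set P k =
     {x. k < horizon P \<and>
       (INF m\<in>{1..}. order_cost P m + dp_G P k (x + m)) < min (scrap_value P x) (dp_G P k x)}"

definition continuation_set :: "'w inventory \<Rightarrow> nat \<Rightarrow> nat set" where
  "continuation_set P k =
     {x. k < horizon P \<and> dp_V P k x = dp_G P k x \<and> dp_G P k x < scrap_value P x}"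

definition ordering_region :: "'w inventory \<Rightarrow> (nat \<times> nat) set" where
  "ordering_region P = {(k, x). k \<le> horizon P \<and> x \<in> ordering_set P k}"

definition stopping_region :: "'w inventory \<Rightarrow> (nat \<times> nat) set" where
  "stopping_region P = {(k, x). k \<le> horizon P \<and> x \<in> stopping_set P k}"

definition continuation_region :: "'w inventory \<Rightarrow> (nat \<times> nat) set" where
  "continuation_region P = {(k, x). k \<le> horizon P \<and> x \<in> continuation_set P k}"

text \<open>A policy is a pair \<open>(\<tau>, \<mu>)\<close>; only the order functions \<open>\<mu> k\<close> up to the horizon matter.\<close>

type_synonym 'w policy = "('w \<Rightarrow> nat) \<times> (nat \<Rightarrow> nat \<Rightarrow> nat)"

definition is_policy :: "'w inventory \<Rightarrow> 'w policy \<Rightarrow> bool" where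
  "is_policy P \<pi> \<longleftrightarrow>
     (\<forall>\<omega>\<in>space (prob_model P). fst \<pi> \<omega> \<le> horizon P) \<and>
     stopping_time (history (prob_model P) (demand P) (real (horizon P))) (\<lambda>\<omega>. real (fst \<pi> \<omega>))"

primrec stock :: "'w inventory \<Rightarrow> 'w policy \<Rightarrow> nat \<Rightarrow> nat \<Rightarrow> 'w \<Rightarrow> nat" where
  "stock P \<pi> x 0 \<omega> = x"
| "stock P \<pi> x (Suc k) \<omega> = leftover P k (stock P \<pi> x k \<omega> + snd \<pi> k (stock P \<pi> x k \<omega>)) \<omega>"

definition policy_cost :: "'w inventory \<Rightarrow> 'w policy \<Rightarrow> nat \<Rightarrow> real" where
  "policy_cost P \<pi> x =
     (\<integral>\<omega>. (\<Sum>k<fst \<pi> \<omega>. exp (- discount P * real k) *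
            (order_cost P (snd \<pi> k (stock P \<pi> x k \<omega>)) +
             period_cost P k (stock P \<pi> x k \<omega> + snd \<pi> k (stock P \<pi> x k \<omega>))))
          + exp (- discount P * real (fst \<pi> \<omega>)) * scrap_value P (stock P \<pi> x (fst \<pi> \<omega>) \<omega>)
       \<partial>prob_model P)"

definition optimal_value :: "'w inventory \<Rightarrow> nat \<Rightarrow> ereal" where
  "optimal_value P x = (INF \<pi>\<in>{\<pi>. is_policy P \<pi>}. ereal (policy_cost P \<pi> x))"

text \<open>
  \<open>optimal_solution P x \<pi>\<close>: \<open>\<pi>\<close> is the solution read off from the recursion for initial stock \<open>x\<close>.
  The order amounts attain the infimum defining \<open>dp_J\<close>; if not ordering attains it as well, nothing
  is ordered. (Without this tie-breaking rule the minimiser need not be 0 on the continuation set.)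
\<close>

definition optimal_solution :: "'w inventory \<Rightarrow> nat \<Rightarrow> 'w policy \<Rightarrow> bool" where
  "optimal_solution P x \<pi> \<longleftrightarrow>
     (\<forall>k<horizon P. \<forall>y.
        order_cost P (snd \<pi> k y) + dp_G P k (y + snd \<pi> k y) = dp_J P k y \<and>
        (order_cost P 0 + dp_G P k y = dp_J P k y \<longrightarrow> snd \<pi> k y = 0)) \<and>
     (\<forall>\<omega>\<in>space (prob_model P).
        fst \<pi> \<omega> = Min {k. k \<le> horizon P \<and> stock P \<pi> x k \<omega> \<in> stopping_set P k})"

definition optimal_order_up_to_level :: "'w inventory \<Rightarrow> nat \<Rightarrow> nat \<Rightarrow> nat \<Rightarrow> bool" where
  "optimal_order_up_to_level P k x y \<longleftrightarrow>
     x < y \<and> order_cost P (y - x) + dp_G P k y = dp_J P k x"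

end

theory Submission
  imports Defs
begin

text \<open>
  One-period costs are bounded below, because the running cost is reduced by at most the expected
  integral of \<open>cost2\<close> against the demand. Since the unit cost exceeds the negative scrap value, it
  follows by backward induction that the cost of raising the stock grows at least linearly, so that
  the infima of the recursion are attained. The stock takes only finitely many values, hence all
  expectations are finite, and since demand increments are independent of the past, the cost of a
  policy telescopes into the value of the recursion plus a sum of non-negative gaps. These gaps
  vanish for the solution read off from the recursion.
\<close>

text \<open>The Bochner integral of a non-integrable function is 0, so an integral can only be
  compared with that of a larger function once the larger one is known to be integrable. The
  hypotheses give this for the expectation of the integral of \<open>cost2\<close> over the whole
  horizon, but path by path it has to be derived, as \<open>cost2\<close> may be unbounded;
  integer-valued paths make it true. The linear lower bound cannot keep one slope for all epochs:
  truncation of the stock at zero and discounting both flatten a positive slope. The induction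
  therefore chooses a new slope \<open>a\<close> at each epoch and preserves just two facts,
  \<open>0 < unit_cost P + a\<close> (ordering is coercive) and \<open>a \<le> scrap_cost P\<close>
  (scrapping respects the bound). Independence is given for events, so the Markov property is
  obtained by splitting over the finitely many stock values and testing on events of the past,
  without conditional expectations.\<close>

section \<open>Integration against integer-valued distribution functions\<close>

text \<open>Half-open intervals have integer measure as differences of values of \<open>F\<close>.
  The property passes to complements by subtraction and to disjoint countable unions because
  \<open>\<int>\<close> is closed, so it reaches all Borel sets from the half-lines. Cutting with
  \<open>{a<..b}\<close> keeps every measure finite.\<close>

lemma interval_measure_Ints:
  fixes F :: "real \<Rightarrow> real"
  assumes mono: "\<And>x y. x \<le> y \<Longrightarrow> F x \<le> F y" and cont: "\<And>x. continuous (at_right x) F"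
    and int: "\<And>x. F x \<in> \<int>" and A: "A \<in> sets borel"
  shows "measure (interval_measure F) (A \<inter> {a<..b}) \<in> \<int>"
proof -
  let ?M = "interval_measure F"
  have fin: "emeasure ?M (X \<inter> {a<..b}) \<noteq> \<infinity>" for X
  proof -
    have "emeasure ?M (X \<inter> {a<..b}) \<le> emeasure ?M {a<..b}"
      by (intro emeasure_mono) auto
    also have "\<dots> < \<infinity>"
      by (cases "a \<le> b") (auto simp: emeasure_interval_measure_Ioc[OF _ mono cont])
    finally show ?thesis by simp
  qed
  have Ioc: "measure ?M {a<..c} \<in> \<int>" for c
    by (cases "a \<le> c") (auto simp: measure_interval_measure_Ioc[OF _ mono cont] int)
  have "Int_stable (range (\<lambda>a::real. {..a}))"
    by (auto simp: Int_stable_def)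
  moreover have "range (\<lambda>a::real. {..a}) \<subseteq> Pow UNIV" by simp
  moreover have "A \<in> sigma_sets UNIV (range (\<lambda>a::real. {..a}))"
    using A by (simp add: borel_eq_atMost)
  ultimately show ?thesis
  proof (induct rule: sigma_sets_induct_disjoint)
    case (basic A)
    then obtain x where x: "A = {..x}" by auto
    have "{..x} \<inter> {a<..b} = {a<..min x b}" by auto
    then show ?case using Ioc[of "min x b"] x by simp
  next
    case (compl A)
    then have "A \<in> sets borel" by (simp add: borel_eq_atMost)
    then have "measure ?M ({a<..b} - A \<inter> {a<..b}) = measure ?M {a<..b} - measure ?M (A \<inter> {a<..b})"
      using fin[of UNIV] by (intro measure_Diff) auto
    moreover have "(UNIV - A) \<inter> {a<..b} = {a<..b} - A \<inter> {a<..b}" by auto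
    ultimately show ?case using Ioc[of b] compl(2) by simp
  next
    case (union A)
    then have "\<And>i. A i \<in> sets borel" by (auto simp: borel_eq_atMost)
    then have "(\<lambda>i. measure ?M (A i \<inter> {a<..b})) sums measure ?M (\<Union>i. A i \<inter> {a<..b})"
      using union(1) fin[of "\<Union>i. A i"]
      by (intro measure_UNION) (auto simp: disjoint_family_on_def)
    then have "measure ?M (\<Union>i. A i \<inter> {a<..b}) \<in> \<int>"
      unfolding sums_def
      by (rule closed_sequentially[OF closed_Ints, rotated]) (use union(3) in \<open>auto intro!: Ints_sum\<close>)
    then show ?case by (simp add: Int_commute)
  qed auto
qed

text \<open>The measure is integer-valued, so the level sets of the integrand, whose measures tend to
  zero, are eventually null: the integrand is essentially bounded.\<close>

lemma set_integrable_interval_measure_Ints: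
  fixes F f :: "real \<Rightarrow> real"
  assumes mono: "\<And>x y. x \<le> y \<Longrightarrow> F x \<le> F y" and cont: "\<And>x. continuous (at_right x) F"
    and int: "\<And>x. F x \<in> \<int>" and f: "set_borel_measurable borel {a<..b} f"
  shows "set_integrable (interval_measure F) {a<..b} f"
proof -
  let ?M = "interval_measure F"
  define g where "g u = indicator {a<..b} u *\<^sub>R f u" for u
  have g[measurable]: "g \<in> borel_measurable borel"
    using f unfolding set_borel_measurable_def g_def .
  define L where "L n = {u. real n < \<bar>g u\<bar>} \<inter> {a<..b}" for n
  have L[measurable]: "L n \<in> sets borel" for n unfolding L_def by measurable
  have fin: "emeasure ?M {a<..b} < \<infinity>"
    by (cases "a \<le> b") (auto simp: emeasure_interval_measure_Ioc[OF _ mono cont])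
  have finL: "emeasure ?M (L n) \<noteq> \<infinity>" for n
    using emeasure_mono[of "L n" "{a<..b}" ?M] fin by (auto simp: L_def top_unique)
  have "(\<Inter>n. L n) = {}"
  proof -
    have "u \<notin> (\<Inter>n. L n)" for u
      using reals_Archimedean2[of "\<bar>g u\<bar>"] by (auto simp: L_def not_less intro: less_imp_le)
    then show ?thesis by blast
  qed
  moreover have "decseq L" by (auto simp: L_def decseq_def)
  ultimately have "(\<lambda>n. measure ?M (L n)) \<longlonglongrightarrow> 0"
    using Lim_measure_decseq[of L ?M] finL by (simp add: image_subset_iff)
  then have "\<forall>\<^sub>F n in sequentially. measure ?M (L n) < 1"
    by (rule order_tendstoD) simp
  then obtain n where n: "measure ?M (L n) < 1"
    by (auto simp: eventually_sequentially)
  \<comment> \<open>A non-negative integer below 1 is 0.\<close>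
  have "measure ?M (L n) \<in> \<int>"
    unfolding L_def by (intro interval_measure_Ints mono cont int) measurable
  with n have "measure ?M (L n) = 0"
    by (metis Ints_nonzero_abs_ge1 abs_of_nonneg measure_nonneg not_less)
  \<comment> \<open>\<open>measure\<close> is also 0 on sets of infinite mass, hence the appeal to
    \<open>finL\<close>.\<close>
  then have "emeasure ?M (L n) = 0"
    using finL[of n] by (simp add: measure_def enn2real_eq_0_iff)
  then have "AE u in ?M. u \<notin> L n"
    by (intro AE_not_in) auto
  then have "AE u in ?M. u \<in> {a<..b} \<longrightarrow> norm (g u) \<le> real n"
    by eventually_elim (auto simp: L_def)
  then have "integrable ?M g"
    using fin by (intro integrableI_bounded_set[of "{a<..b}"]) (auto simp: g_def)
  then show ?thesis unfolding set_integrable_def g_def .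
qed

section \<open>Attained infima over the natural numbers\<close>

lemma coercive_INF:
  fixes f :: "nat \<Rightarrow> real"
  assumes "0 < \<alpha>" and f: "\<And>m. \<alpha> * real m + \<beta> \<le> f m"
  shows "bdd_below (range f)" and "\<exists>m. f m = (INF m. f m)"
proof -
  have lb: "\<beta> \<le> f m" for m
    using f[of m] \<open>0 < \<alpha>\<close> by (smt (verit) mult_nonneg_nonneg of_nat_0_le_iff)
  then show bdd: "bdd_below (range f)" by (auto intro!: bdd_belowI)
  \<comment> \<open>Beyond \<open>M\<close> the linear bound already exceeds \<open>f 0\<close>, so
    a minimiser over the finite set \<open>{..M}\<close> is a global one.\<close>
  obtain M :: nat where M: "f 0 - \<beta> < real M * \<alpha>"
    using reals_Archimedean3[OF \<open>0 < \<alpha>\<close>] by blast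
  obtain m where m: "m \<le> M" "\<And>j. j \<le> M \<Longrightarrow> f m \<le> f j"
    using arg_min_if_finite(1)[of "{..M}" f] arg_min_least[of "{..M}" _ f] by force
  have "f m \<le> f j" for j
  proof (cases "j \<le> M")
    case False
    then have "real M * \<alpha> \<le> real j * \<alpha>" using \<open>0 < \<alpha>\<close> by (intro mult_right_mono) auto
    then have "f 0 < f j" using M f[of j] by (simp add: mult.commute)
    then show ?thesis using m(2)[of 0] by simp
  qed (use m in auto)
  then have "f m = (INF m. f m)"
    by (intro antisym cINF_greatest cINF_lower bdd) auto
  then show "\<exists>m. f m = (INF m. f m)" ..
qed

text \<open>Separates the free option of ordering nothing from the genuine orders.\<close>

lemma INF_nat_split:
  fixes f :: "nat \<Rightarrow> real"
  assumes "bdd_below (range f)"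
  shows "(INF m. f m) = min (f 0) (INF m\<in>{1..}. f m)"
proof -
  have U: "(UNIV :: nat set) = insert 0 {1..}" by force
  have "bdd_below (f ` {1..})" using assms by (rule bdd_below_mono) auto
  then show ?thesis unfolding U by (subst cINF_insert) (auto simp: inf_min)
qed

section \<open>Histories and integrability of bounded discrete variables\<close>

lemma space_history [simp]: "space (history M N H t) = space M"
  unfolding history_def by (rule space_measure_of) auto

lemma sets_history:
  "sets (history M N H t) =
    sigma_sets (space M) {N s -` A \<inter> space M | s A. 0 \<le> s \<and> s \<le> t \<and> s \<le> H}"
  unfolding history_def by (rule sets_measure_of) auto

lemma history_mono: "s \<le> t \<Longrightarrow> sets (history M N H s) \<subseteq> sets (history M N H t)"
  unfolding sets_history by (rule sigma_sets_mono') force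

lemma measurable_history:
  assumes "0 \<le> s" "s \<le> t" "s \<le> H"
  shows "N s \<in> measurable (history M N H t) (count_space UNIV)"
  using assms by (intro measurableI) (auto simp: sets_history intro!: sigma_sets.Basic)

lemma measurable_nat_if_atMost:
  fixes X :: "'w \<Rightarrow> nat"
  assumes "space M' = space M" "sets M' \<subseteq> sets M" "X \<in> measurable M' (count_space UNIV)"
  shows "X \<in> measurable M (count_space UNIV)"
  using assms by (auto simp: measurable_def)

text \<open>Only the values of \<open>f\<close> on \<open>{..B}\<close> matter. In this way
  expectations of recursion values are finite although \<open>dp_V\<close> is controlled from below
  only.\<close>

lemma (in finite_measure) integrable_bounded_nat:
  fixes X :: "'a \<Rightarrow> nat" and f :: "nat \<Rightarrow> real"
  assumes [measurable]: "X \<in> measurable M (count_space UNIV)"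
    and X: "\<And>\<omega>. \<omega> \<in> space M \<Longrightarrow> X \<omega> \<le> B"
  shows "integrable M (\<lambda>\<omega>. f (X \<omega>))"
proof (rule integrable_const_bound[where B = "Max ((\<lambda>z. \<bar>f z\<bar>) ` {..B})"])
  show "AE \<omega> in M. norm (f (X \<omega>)) \<le> Max ((\<lambda>z. \<bar>f z\<bar>) ` {..B})"
    using X by (intro AE_I2) auto
qed measurable

section \<open>Demand paths and one-period costs\<close>

context
  fixes P :: "'w inventory"
  assumes P: "inventory_problem P"
begin

interpretation prob_space "prob_model P"
  using P by (simp add: inventory_problem_def poisson_process_def)

abbreviation "M \<equiv> prob_model P"
abbreviation "hist k \<equiv> history M (demand P) (real (horizon P)) (real k)"

lemma demand_measurable: "0 \<le> t \<Longrightarrow> t \<le> real (horizon P) \<Longrightarrow> demand P t \<in> measurable M (count_space UNIV)"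
  using P by (simp add: inventory_problem_def poisson_process_def)

lemma demand_mono:
  "\<omega> \<in> space M \<Longrightarrow> 0 \<le> s \<Longrightarrow> s \<le> t \<Longrightarrow> t \<le> real (horizon P) \<Longrightarrow> demand P s \<omega> \<le> demand P t \<omega>"
  using P by (auto simp: inventory_problem_def poisson_process_def mono_on_def)

lemma demand_right_continuous:
  "\<omega> \<in> space M \<Longrightarrow> 0 \<le> t \<Longrightarrow> t < real (horizon P) \<Longrightarrow>
    continuous (at_right t) (\<lambda>s. real (demand P s \<omega>))"
  using P by (auto simp: inventory_problem_def poisson_process_def)

lemma sets_history_subset: "sets (history M (demand P) (real (horizon P)) t) \<subseteq> sets M"
  unfolding sets_history
  using demand_measurable by (intro sets.sigma_sets_subset) (auto intro: measurable_sets)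

text \<open>The extended path is monotone, right-continuous and integer-valued. The result serves to
  compare integrals of smaller integrands along the same path.\<close>

lemma dN_integral_cost2_integrable:
  assumes \<omega>: "\<omega> \<in> space M"
  shows "set_integrable (interval_measure
      (\<lambda>u. real (demand P (max 0 (min (real (horizon P)) u)) \<omega>))) {0<..real (horizon P)} (cost2 P)"
proof (rule set_integrable_interval_measure_Ints)
  let ?H = "real (horizon P)"
  let ?F = "\<lambda>u. real (demand P (max 0 (min ?H u)) \<omega>)"
  show "?F x \<le> ?F y" if "x \<le> y" for x y
    using that by (auto intro!: demand_mono \<omega>)
  \<comment> \<open>Right-continuity at \<open>x\<close> depends only on the values at
    \<open>x\<close> and just to its right. There the extended path agrees with a constant or with
    the original path.\<close>
  have *: "continuous (at_right x) ?F"
    if e: "\<forall>\<^sub>F u in at_right x. ?F u = G u" "?F x = G x" and G: "continuous (at_right x) G" for x G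
    using G tendsto_cong[OF e(1)] e(2) by (simp add: continuous_within)
  show "continuous (at_right x) ?F" for x
  proof -
    consider "x < 0" | "0 \<le> x" "x < ?H" | "?H \<le> x" by linarith
    then show ?thesis
    proof cases
      case 1
      have "\<forall>\<^sub>F u in at_right x. ?F u = real (demand P 0 \<omega>)"
        using 1 by (auto simp: eventually_at_right_field intro!: exI[of _ 0])
      then show ?thesis by (rule *) (use 1 in auto)
    next
      case 2
      have "\<forall>\<^sub>F u in at_right x. ?F u = real (demand P u \<omega>)"
        using 2 by (auto simp: eventually_at_right_field intro!: exI[of _ ?H])
      then show ?thesis by (rule *) (use 2 demand_right_continuous[OF \<omega>, of x] in auto)
    next
      case 3
      have "\<forall>\<^sub>F u in at_right x. ?F u = real (demand P ?H \<omega>)"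
        using 3 by (auto simp: eventually_at_right_field intro!: exI[of _ "x + 1"])
      then show ?thesis by (rule *) (use 3 in auto)
    qed
  qed
  have "set_borel_measurable borel {0..?H} (cost2 P)"
    using P by (simp add: inventory_problem_def)
  then show "set_borel_measurable borel {0<..?H} (cost2 P)"
    by (rule set_borel_measurable_subset) auto
qed auto

lemma period_cost_bounded_below: "\<exists>b\<ge>0. \<forall>k<horizon P. \<forall>y. - b \<le> period_cost P k y"
proof -
  let ?H = "real (horizon P)"
  let ?I = "\<lambda>\<omega>. dN_integral P (cost2 P) 0 (ereal ?H) \<omega>"
  have c: "0 \<le> cost2 P t" "cost3 P t \<le> cost2 P t" if "0 \<le> t" "t \<le> ?H" for t
  proof -
    have "\<forall>t\<in>{0..?H}. 0 \<le> cost3 P t \<and> cost3 P t \<le> cost2 P t"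
      using P by (simp add: inventory_problem_def)
    then have "0 \<le> cost3 P t \<and> cost3 P t \<le> cost2 P t"
      by (rule bspec) (use that in simp)
    then show "0 \<le> cost2 P t" "cost3 P t \<le> cost2 P t" by auto
  qed
  have \<delta>: "0 \<le> discount P" "0 \<le> holding_rate P" and I: "integrable M ?I"
    using P by (auto simp: inventory_problem_def)
  have I0: "0 \<le> ?I \<omega>" for \<omega>
    unfolding dN_integral_def set_lebesgue_integral_def
    by (intro integral_nonneg_AE AE_I2) (auto simp: indicator_def c)
  have "- (\<integral>\<omega>. ?I \<omega> \<partial>M) \<le> period_cost P k y" if k: "k < horizon P" for k y
  proof -
    \<comment> \<open>\<open>integral_mono'\<close> asks for integrability and non-negativity of the
      larger function only: if the smaller one is not integrable, its integral is 0. So nothing has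
      to be proved about measurability of the depletion time.\<close>
    have "(\<integral>\<omega>. dN_integral P (\<lambda>u. exp (- discount P * (u - real k)) * cost2 P u)
          (real k) (min (ereal (real (k + 1))) (depletion_time P k y \<omega>)) \<omega> \<partial>M) \<le> (\<integral>\<omega>. ?I \<omega> \<partial>M)"
    proof (intro integral_mono' I I0)
      fix \<omega> assume \<omega>: "\<omega> \<in> space M"
      have *: "{u. 0 < u \<and> ereal u \<le> ereal ?H} = {0<..?H}" by auto
      show "dN_integral P (\<lambda>u. exp (- discount P * (u - real k)) * cost2 P u)
          (real k) (min (ereal (real (k + 1))) (depletion_time P k y \<omega>)) \<omega> \<le> ?I \<omega>"
        unfolding dN_integral_def * set_lebesgue_integral_def
      proof (intro integral_mono' dN_integral_cost2_integrable[OF \<omega>, unfolded set_integrable_def])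
        fix u
        show "0 \<le> indicat_real {0<..?H} u *\<^sub>R cost2 P u"
          by (auto simp: indicator_def c)
        have "exp (- discount P * (u - real k)) * cost2 P u \<le> cost2 P u"
          if "real k < u" "u \<le> ?H"
          using c(1)[of u] \<delta> that by (intro mult_left_le_one_le) auto
        then show "indicat_real {u. real k < u \<and>
              ereal u \<le> min (ereal (real (k + 1))) (depletion_time P k y \<omega>)} u *\<^sub>R
            (exp (- discount P * (u - real k)) * cost2 P u) \<le> indicat_real {0<..?H} u *\<^sub>R cost2 P u"
          using c(1)[of u] k by (auto simp: indicator_def)
      qed
    qed
    moreover have "0 \<le> (\<integral>\<omega>. dN_integral P
        (\<lambda>u. exp (- discount P * (u - real k)) * (cost2 P u - cost3 P u))
          (real k) (ereal (real (k + 1))) \<omega> \<partial>M)"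
      unfolding dN_integral_def set_lebesgue_integral_def
      using k by (intro integral_nonneg_AE AE_I2) (auto simp: indicator_def c)
    moreover have "0 \<le> holding_rate P *
       (\<integral>\<omega>. (LINT u:{real k..real (k + 1)}|lborel. exp (- discount P * (u - real k)) *
          max 0 (real y - (real (demand P u \<omega>) - real (demand P (real k) \<omega>)))) \<partial>M)"
      unfolding set_lebesgue_integral_def
      by (intro mult_nonneg_nonneg \<delta> integral_nonneg_AE AE_I2) auto
    ultimately show ?thesis unfolding period_cost_def by linarith
  qed
  moreover have "0 \<le> (\<integral>\<omega>. ?I \<omega> \<partial>M)" using I0 by simp
  ultimately show ?thesis by blast
qed

section \<open>Leftover stock and linear lower bounds for the recursion\<close>

lemma leftover_eq:
  assumes "k < horizon P" "\<omega> \<in> space M"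
  shows "leftover P k y \<omega> = y - (demand P (real (k + 1)) \<omega> - demand P (real k) \<omega>)"
  using demand_mono[OF assms(2), of "real k" "real (k + 1)"] assms(1)
  unfolding leftover_def by (simp add: of_nat_diff)

lemma leftover_le: "k < horizon P \<Longrightarrow> \<omega> \<in> space M \<Longrightarrow> leftover P k y \<omega> \<le> y"
  by (simp add: leftover_eq)

lemma leftover_measurable_history:
  assumes k: "k < horizon P"
  shows "leftover P k y \<in> measurable (hist (k + 1)) (count_space UNIV)"
proof -
  have [measurable]: "demand P (real (k + 1)) \<in> measurable (hist (k + 1)) (count_space UNIV)"
    "demand P (real k) \<in> measurable (hist (k + 1)) (count_space UNIV)"
    using k by (auto intro!: measurable_history)
  show ?thesis unfolding leftover_def[abs_def] by measurable
qed

lemma leftover_measurable: "k < horizon P \<Longrightarrow> leftover P k y \<in> measurable M (count_space UNIV)"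
  by (rule measurable_nat_if_atMost[OF _ sets_history_subset leftover_measurable_history]) auto

lemma leftover_integrable:
  "k < horizon P \<Longrightarrow> integrable M (\<lambda>\<omega>. v (leftover P k y \<omega>) :: real)"
  by (rule integrable_bounded_nat[OF leftover_measurable leftover_le])

text \<open>For a non-negative slope, the leftover is bounded below only on an event of positive
  probability, on which the demand is bounded; the slope shrinks by that probability.\<close>

lemma dp_G_linear_lower_bound:
  assumes k: "k < horizon P"
    and V: "0 < unit_cost P + a" "a \<le> scrap_cost P" "\<And>z. a * real z - B \<le> dp_V P (k + 1) z"
  shows "\<exists>a B. 0 < unit_cost P + a \<and> a \<le> scrap_cost P \<and> (\<forall>y. a * real y - B \<le> dp_G P k y)"
proof -
  define d where "d = exp (- discount P)"
  have d: "0 < d" "d \<le> 1" using P by (auto simp: d_def inventory_problem_def)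
  obtain b where b: "\<And>y. - b \<le> period_cost P k y"
    using period_cost_bounded_below k by blast
  have G: "- b + d * c \<le> dp_G P k y"
    if "c \<le> (\<integral>\<omega>. dp_V P (k + 1) (leftover P k y \<omega>) \<partial>M)" for c y
    using b[of y] mult_left_mono[OF that, of d] d unfolding dp_G.simps[of P k y] d_def by linarith
  have int: "integrable M (\<lambda>\<omega>. dp_V P (k + 1) (leftover P k y \<omega>))" for y
    using k by (rule leftover_integrable)
  show ?thesis
  proof (cases "0 \<le> a")
    case True
    define D where "D \<omega> = demand P (real (k + 1)) \<omega> - demand P (real k) \<omega>" for \<omega>
    have [measurable]: "demand P (real (k + 1)) \<in> measurable M (count_space UNIV)"
      "demand P (real k) \<in> measurable M (count_space UNIV)"
      using k by (auto intro!: demand_measurable)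
    have D[measurable]: "D \<in> measurable M (count_space UNIV)"
      unfolding D_def[abs_def] by measurable
    define A where "A n = {\<omega> \<in> space M. D \<omega> \<le> n}" for n
    have A[measurable, simp]: "A n \<in> sets M" for n unfolding A_def by measurable
    \<comment> \<open>The events \<open>A n\<close> exhaust the space, so they cannot all be
      null.\<close>
    have "\<exists>n. 0 < prob (A n)"
    proof (rule ccontr)
      assume "\<nexists>n. 0 < prob (A n)"
      then have "prob (A n) = 0" for n
        using measure_nonneg[of M "A n"] by (metis less_le)
      then have "emeasure M (\<Union>n. A n) = 0"
        by (intro emeasure_UN_eq_0) (auto simp: emeasure_eq_measure)
      moreover have "(\<Union>n. A n) = space M" by (auto simp: A_def)
      ultimately show False by (simp add: emeasure_space_1)
    qed
    then obtain n where n: "0 < prob (A n)" ..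
    define p where "p = prob (A n)"
    have p: "0 < p" "p \<le> 1" using n by (auto simp: p_def)
    have E: "a * (real y - real n) * p - B \<le> (\<integral>\<omega>. dp_V P (k + 1) (leftover P k y \<omega>) \<partial>M)" for y
    proof -
      have "(\<integral>\<omega>. a * (real y - real n) * indicat_real (A n) \<omega> - B \<partial>M)
          \<le> (\<integral>\<omega>. dp_V P (k + 1) (leftover P k y \<omega>) \<partial>M)"
      proof (intro integral_mono int)
        fix \<omega> assume \<omega>: "\<omega> \<in> space M"
        \<comment> \<open>Off \<open>A n\<close> the left side is 0. On \<open>A n\<close> at most
          \<open>n\<close> units are sold, and for \<open>y < n\<close> the left side is
          negative.\<close>
        have "(real y - real n) * indicat_real (A n) \<omega> \<le> real (leftover P k y \<omega>)"
          by (auto simp: leftover_eq[OF k \<omega>] A_def D_def indicator_def)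
        then have "a * ((real y - real n) * indicat_real (A n) \<omega>) \<le> a * real (leftover P k y \<omega>)"
          using True by (rule mult_left_mono)
        then show "a * (real y - real n) * indicat_real (A n) \<omega> - B
            \<le> dp_V P (k + 1) (leftover P k y \<omega>)"
          using V(3)[of "leftover P k y \<omega>"] by (simp add: mult.assoc)
      qed (simp add: emeasure_eq_measure)
      moreover have "(\<integral>\<omega>. a * (real y - real n) * indicat_real (A n) \<omega> - B \<partial>M)
          = a * (real y - real n) * p - B"
        by (subst Bochner_Integration.integral_diff) (simp_all add: p_def prob_space emeasure_eq_measure)
      ultimately show ?thesis by simp
    qed
    \<comment> \<open>The new slope \<open>d * p * a\<close> lies between 0 and \<open>a\<close>,
      hence below the scrap cost. It keeps \<open>unit_cost P + d * p * a\<close> positive: for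
      \<open>a = 0\<close> this is the hypothesis, otherwise the slope itself is positive.\<close>
    have "d * p \<le> 1" "0 \<le> d * p" using d p by (auto intro: mult_le_one)
    then have "d * p * a \<le> a" using True by (intro mult_left_le_one_le) auto
    moreover have "0 < unit_cost P + d * p * a"
      using V(1) True d p P
      by (cases "a = 0") (auto simp: inventory_problem_def intro!: add_nonneg_pos)
    moreover have "d * p * a * real y - (b + d * (a * real n * p + B)) \<le> dp_G P k y" for y
      using G[OF E[of y]] by (simp add: algebra_simps)
    ultimately show ?thesis using V(2) by (intro exI[of _ "d * p * a"] exI) auto
  next
    \<comment> \<open>For a negative slope, \<open>leftover P k y \<omega> \<le> y\<close> gives the
      bound on every path, and discounting raises a non-positive quantity, so \<open>a\<close>
      itself survives.\<close>
    case False
    have E: "a * real y - B \<le> (\<integral>\<omega>. dp_V P (k + 1) (leftover P k y \<omega>) \<partial>M)" for y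
    proof -
      have "(\<integral>\<omega>. a * real y - B \<partial>M) \<le> (\<integral>\<omega>. dp_V P (k + 1) (leftover P k y \<omega>) \<partial>M)"
      proof (intro integral_mono int)
        fix \<omega> assume \<omega>: "\<omega> \<in> space M"
        have "a * real y \<le> a * real (leftover P k y \<omega>)"
          using leftover_le[OF k \<omega>, of y] False by (intro mult_left_mono_neg) auto
        then show "a * real y - B \<le> dp_V P (k + 1) (leftover P k y \<omega>)"
          using V(3)[of "leftover P k y \<omega>"] by linarith
      qed simp
      then show ?thesis by (simp add: prob_space)
    qed
    have "a * real y - (b + d * B) \<le> dp_G P k y" for y
    proof -
      have "d * (a * real y) \<ge> 1 * (a * real y)"
        using d False by (intro mult_right_mono_neg) (auto intro: mult_nonpos_nonneg)
      then show ?thesis using G[OF E[of y]] by (simp add: algebra_simps)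
    qed
    then show ?thesis using V(1,2) by blast
  qed
qed

text \<open>The fixed cost is bounded below by 0. The slope in \<open>m\<close> is the quantity that
  the induction keeps positive.\<close>

lemma dp_J_summand_lower_bound:
  assumes "\<And>y. a * real y - B \<le> dp_G P k y"
  shows "(unit_cost P + a) * real m + (a * real x - B) \<le> order_cost P m + dp_G P k (x + m)"
proof -
  have "unit_cost P * real m \<le> order_cost P m"
    using P by (auto simp: order_cost_def inventory_problem_def)
  then show ?thesis using assms[of "x + m"] by (simp add: algebra_simps)
qed

text \<open>At the horizon the slope is \<open>scrap_cost P\<close>, and positivity of
  \<open>unit_cost P + scrap_cost P\<close> is the assumption on the scrapping cost. Minimising over
  orders then preserves the bound on \<open>dp_G\<close>, as larger orders only add to it.\<close>

lemma dp_V_linear_lower_bound: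
  assumes "k \<le> horizon P"
  shows "\<exists>a B. 0 < unit_cost P + a \<and> a \<le> scrap_cost P \<and> (\<forall>z. a * real z - B \<le> dp_V P k z)"
  using assms
proof (induction k rule: inc_induct)
  case base
  show ?case using P
    by (intro exI[of _ "scrap_cost P"] exI[of _ 0])
      (auto simp: dp_V.simps scrap_value_def inventory_problem_def)
next
  case (step k)
  then obtain a' B' where "0 < unit_cost P + a'" "a' \<le> scrap_cost P"
    "\<And>z. a' * real z - B' \<le> dp_V P (k + 1) z"
    by auto
  then obtain a B where ab: "0 < unit_cost P + a" "a \<le> scrap_cost P"
    and G: "\<And>y. a * real y - B \<le> dp_G P k y"
    using dp_G_linear_lower_bound[OF step.hyps(2)] by blast
  \<comment> \<open>The scrap value lies above \<open>a * real z\<close>, so the offset must not be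
    negative: hence \<open>max B 0\<close>.\<close>
  have "a * real z - max B 0 \<le> dp_V P k z" for z
  proof -
    have "a * real z - B \<le> order_cost P m + dp_G P k (z + m)" for m
      using dp_J_summand_lower_bound[where m = m and x = z, OF G] ab(1)
        mult_nonneg_nonneg[of "unit_cost P + a" "real m"] by linarith
    then have "a * real z - B \<le> dp_J P k z"
      unfolding dp_J.simps by (intro cINF_greatest) auto
    moreover have "a * real z \<le> scrap_value P z"
      unfolding scrap_value_def using ab(2) by (intro mult_right_mono) auto
    ultimately show ?thesis using step.hyps unfolding dp_V.simps[of P k z] by auto
  qed
  with ab show ?case by blast
qed

section \<open>Attained infima in the recursion and the three sets\<close>

text \<open>The real-valued \<open>INF\<close> is a genuine lower bound only for sets bounded below,
  so boundedness is recorded along with the minimiser.\<close>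

lemma dp_J_attained:
  assumes k: "k < horizon P"
  shows "bdd_below (range (\<lambda>m. order_cost P m + dp_G P k (x + m)))"
    and "\<exists>m. order_cost P m + dp_G P k (x + m) = dp_J P k x"
proof -
  from dp_V_linear_lower_bound[of "k + 1"] k obtain a B where "0 < unit_cost P + a"
    and G: "\<And>y. a * real y - B \<le> dp_G P k y"
    using dp_G_linear_lower_bound[OF k] by (metis Suc_eq_plus1 Suc_leI)
  note * = coercive_INF[OF this(1), of "a * real x - B" "\<lambda>m. order_cost P m + dp_G P k (x + m)",
      OF dp_J_summand_lower_bound[OF G]]
  show "bdd_below (range (\<lambda>m. order_cost P m + dp_G P k (x + m)))" by (rule *)
  show "\<exists>m. order_cost P m + dp_G P k (x + m) = dp_J P k x" unfolding dp_J.simps by (rule *)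
qed

lemma dp_J_le: "k < horizon P \<Longrightarrow> dp_J P k x \<le> order_cost P m + dp_G P k (x + m)"
  unfolding dp_J.simps by (rule cINF_lower[OF dp_J_attained(1)]) auto

lemma dp_J_eq:
  assumes k: "k < horizon P"
  shows "dp_J P k x = min (dp_G P k x) (INF m\<in>{1..}. order_cost P m + dp_G P k (x + m))"
  unfolding dp_J.simps INF_nat_split[OF dp_J_attained(1)[OF k]] by (simp add: order_cost_def)

lemma dp_V_le_scrap: "dp_V P k x \<le> scrap_value P x"
  by (simp add: dp_V.simps)

lemma stopping_set_iff: "x \<in> stopping_set P k \<longleftrightarrow> (k < horizon P \<longrightarrow> scrap_value P x \<le> dp_J P k x)"
  by (simp add: stopping_set_def)

text \<open>\<open>dp_J\<close> is the minimum of \<open>dp_G\<close> and the infimum over positive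
  orders; it is strictly below \<open>dp_G\<close> exactly when that infimum is.\<close>

lemma ordering_set_iff:
  "x \<in> ordering_set P k \<longleftrightarrow> k < horizon P \<and> dp_J P k x < scrap_value P x \<and> dp_J P k x < dp_G P k x"
  unfolding ordering_set_def using dp_J_eq[of k x] by auto

text \<open>If \<open>dp_G\<close> is strictly below the scrap value and equals \<open>dp_V\<close>,
  then the minimum defining \<open>dp_V\<close> is \<open>dp_J\<close>.\<close>

lemma continuation_set_iff:
  "x \<in> continuation_set P k \<longleftrightarrow>
    k < horizon P \<and> dp_J P k x < scrap_value P x \<and> dp_J P k x = dp_G P k x"
  using dp_J_le[of k x 0] dp_V.simps[of P k x]
  by (auto simp: continuation_set_def order_cost_def min_def split: if_splits)

section \<open>The stock process under a policy\<close>

lemma stock_measurable_history: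
  "k \<le> horizon P \<Longrightarrow> stock P \<pi> x k \<in> measurable (hist k) (count_space UNIV)"
proof (induction k)
  case 0
  have "stock P \<pi> x 0 = (\<lambda>_. x)" by (rule ext) simp
  then show ?case by simp
next
  case (Suc k)
  have "stock P \<pi> x k \<in> measurable (hist (Suc k)) (count_space UNIV)"
    using Suc by (intro measurable_nat_if_atMost[OF _ history_mono Suc.IH]) auto
  then have "(\<lambda>\<omega>. stock P \<pi> x k \<omega> + snd \<pi> k (stock P \<pi> x k \<omega>))
      \<in> measurable (hist (Suc k)) (count_space UNIV)"
    by measurable
  moreover have "leftover P k y \<in> measurable (hist (Suc k)) (count_space UNIV)" for y
    using leftover_measurable_history[of k y] Suc.prems by simp
  \<comment> \<open>The stock after ordering enters \<open>leftover\<close> as a random argument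
    with countably many values, so measurability for each fixed level suffices.\<close>
  ultimately show ?case
    unfolding stock.simps by (rule measurable_compose_countable[rotated])
qed

lemma stock_measurable:
  "k \<le> horizon P \<Longrightarrow> stock P \<pi> x k \<in> measurable M (count_space UNIV)"
  by (rule measurable_nat_if_atMost[OF _ sets_history_subset stock_measurable_history]) auto

text \<open>Demand only lowers the stock, and from finitely many levels the order function reaches
  finitely many. The bound depends on the policy and the epoch.\<close>

lemma stock_bounded: "k \<le> horizon P \<Longrightarrow> \<exists>B. \<forall>\<omega>\<in>space M. stock P \<pi> x k \<omega> \<le> B"
proof (induction k)
  case (Suc k)
  then obtain B where B: "\<And>\<omega>. \<omega> \<in> space M \<Longrightarrow> stock P \<pi> x k \<omega> \<le> B"
    using Suc_leD by blast
  let ?f = "\<lambda>z. z + snd \<pi> k z"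
  have "stock P \<pi> x (Suc k) \<omega> \<le> Max (?f ` {..B})" if \<omega>: "\<omega> \<in> space M" for \<omega>
  proof -
    have "stock P \<pi> x (Suc k) \<omega> \<le> ?f (stock P \<pi> x k \<omega>)"
      using leftover_le[OF _ \<omega>] Suc.prems by simp
    also have "\<dots> \<le> Max (?f ` {..B})" using B[OF \<omega>] by (intro Max_ge) auto
    finally show ?thesis .
  qed
  then show ?case by blast
qed auto

lemma stock_integrable:
  "k \<le> horizon P \<Longrightarrow> integrable M (\<lambda>\<omega>. f (stock P \<pi> x k \<omega>) :: real)"
  using stock_bounded[of k \<pi> x] by (auto intro!: integrable_bounded_nat stock_measurable)

text \<open>The stock ignores the stopping time, so a stopping time may be defined through the stock
  without circularity.\<close>

lemma stock_cong: "snd \<pi> = snd \<pi>' \<Longrightarrow> stock P \<pi> x k \<omega> = stock P \<pi>' x k \<omega>"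
  by (induction k) auto

section \<open>Independence of increments and the cost decomposition\<close>

text \<open>For fixed \<open>y\<close>, the value is a finite combination of indicators of events
  \<open>E z\<close> of the demand increment, and each of these is independent of
  \<open>A\<close>.\<close>

lemma expectation_leftover_indep:
  assumes k: "k < horizon P" and A: "A \<in> sets (hist k)"
  shows "(\<integral>\<omega>. indicat_real A \<omega> * v (leftover P k y \<omega>) \<partial>M)
    = prob A * (\<integral>\<omega>. v (leftover P k y \<omega>) \<partial>M)"
proof -
  define D where "D \<omega> = demand P (real (k + 1)) \<omega> - demand P (real k) \<omega>" for \<omega>
  define E where "E z = {\<omega> \<in> space M. leftover P k y \<omega> = z}" for z
  have indep: "indep_set (sets (hist k)) (sets (vimage_algebra (space M) D (count_space UNIV)))"
  proof -
    have "\<forall>s t. 0 \<le> s \<and> s \<le> t \<and> t \<le> real (horizon P) \<longrightarrow>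
        indep_set (sets (history M (demand P) (real (horizon P)) s))
          (sets (vimage_algebra (space M) (\<lambda>\<omega>. demand P t \<omega> - demand P s \<omega>) (count_space UNIV)))"
      using P unfolding inventory_problem_def poisson_process_def by blast
    from this[rule_format, of "real k" "real (k + 1)"] show ?thesis
      using k by (simp add: D_def[abs_def])
  qed
  have [measurable]: "leftover P k y \<in> measurable M (count_space UNIV)"
    by (rule leftover_measurable[OF k])
  have [measurable]: "E z \<in> sets M" for z unfolding E_def by measurable
  have [measurable]: "A \<in> sets M" using A sets_history_subset by auto
  have "E z \<in> sets (vimage_algebra (space M) D (count_space UNIV))" for z
  proof -
    have "E z = D -` {n. y - n = z} \<inter> space M"
      by (auto simp: E_def D_def leftover_eq[OF k])
    then show ?thesis using in_vimage_algebra[of "{n. y - n = z}" "count_space UNIV" D "space M"] by simp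
  qed
  then have ind: "prob (A \<inter> E z) = prob A * prob (E z)" for z
    using indep_setD[OF indep A] by auto
  have v: "v (leftover P k y \<omega>) = (\<Sum>z\<le>y. v z * indicat_real (E z) \<omega>)" if "\<omega> \<in> space M" for \<omega>
  proof -
    have "(\<Sum>z\<le>y. v z * indicat_real (E z) \<omega>) = (\<Sum>z\<le>y. if z = leftover P k y \<omega> then v z else 0)"
      using that by (intro sum.cong) (auto simp: E_def indicator_def)
    then show ?thesis using leftover_le[OF k that] by simp
  qed
  have "(\<integral>\<omega>. indicat_real A \<omega> * v (leftover P k y \<omega>) \<partial>M)
      = (\<integral>\<omega>. (\<Sum>z\<le>y. v z * indicat_real (A \<inter> E z) \<omega>) \<partial>M)"
    by (intro Bochner_Integration.integral_cong refl)
      (simp only: v sum_distrib_left indicator_inter_arith mult_ac)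
  also have "\<dots> = (\<Sum>z\<le>y. v z * prob (A \<inter> E z))"
    by (subst Bochner_Integration.integral_sum) (simp_all add: emeasure_eq_measure)
  also have "\<dots> = prob A * (\<Sum>z\<le>y. v z * prob (E z))"
    by (simp add: ind sum_distrib_left ac_simps)
  also have "(\<Sum>z\<le>y. v z * prob (E z)) = (\<integral>\<omega>. (\<Sum>z\<le>y. v z * indicat_real (E z) \<omega>) \<partial>M)"
    by (subst Bochner_Integration.integral_sum) (simp_all add: emeasure_eq_measure)
  also have "\<dots> = (\<integral>\<omega>. v (leftover P k y \<omega>) \<partial>M)"
    by (intro Bochner_Integration.integral_cong refl) (simp only: v)
  finally show ?thesis .
qed

text \<open>The Markov property in integrated form: on an event of the past, the next state may be
  averaged with the present stock frozen.\<close>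

lemma expectation_leftover:
  assumes k: "k < horizon P" and A: "A \<in> sets (hist k)"
    and X: "X \<in> measurable (hist k) (count_space (UNIV :: nat set))"
    and B: "\<And>\<omega>. \<omega> \<in> space M \<Longrightarrow> X \<omega> \<le> B"
  shows "(\<integral>\<omega>. indicat_real A \<omega> * v (leftover P k (f (X \<omega>)) \<omega>) \<partial>M)
    = (\<integral>\<omega>. indicat_real A \<omega> * (\<integral>\<omega>'. v (leftover P k (f (X \<omega>)) \<omega>') \<partial>M) \<partial>M)"
proof -
  define E where "E z = A \<inter> {\<omega> \<in> space M. X \<omega> = z}" for z
  have "{\<omega> \<in> space M. X \<omega> = z} \<in> sets (hist k)" for z
    using measurable_sets[OF X, of "{z}"] by (simp add: vimage_def Int_def conj_commute)
  then have E: "E z \<in> sets (hist k)" for z using A unfolding E_def by auto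
  then have [measurable]: "E z \<in> sets M" for z using sets_history_subset by auto
  \<comment> \<open>\<open>u\<close> is chosen separately for each \<open>\<omega>\<close>; in the
    first use it is the value of the leftover on that very path.\<close>
  have split: "indicat_real A \<omega> * u (X \<omega>) = (\<Sum>z\<le>B. indicat_real (E z) \<omega> * u z)"
    if "\<omega> \<in> space M" for \<omega> and u :: "nat \<Rightarrow> real"
  proof -
    have "(\<Sum>z\<le>B. indicat_real (E z) \<omega> * u z) = (\<Sum>z\<le>B. if z = X \<omega> then indicat_real A \<omega> * u z else 0)"
      using that by (intro sum.cong) (auto simp: E_def indicator_def)
    then show ?thesis using B[OF that] by simp
  qed
  have "(\<integral>\<omega>. indicat_real A \<omega> * v (leftover P k (f (X \<omega>)) \<omega>) \<partial>M)
      = (\<integral>\<omega>. (\<Sum>z\<le>B. indicat_real (E z) \<omega> * v (leftover P k (f z) \<omega>)) \<partial>M)"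
    by (intro Bochner_Integration.integral_cong refl) (rule split)
  also have "\<dots> = (\<Sum>z\<le>B. prob (E z) * (\<integral>\<omega>'. v (leftover P k (f z) \<omega>') \<partial>M))"
    by (subst Bochner_Integration.integral_sum)
      (auto simp: expectation_leftover_indep[OF k E]
        intro!: integrable_mult_indicator[where 'b = real, simplified] leftover_integrable k)
  also have "\<dots> = (\<integral>\<omega>. (\<Sum>z\<le>B. indicat_real (E z) \<omega> * (\<integral>\<omega>'. v (leftover P k (f z) \<omega>') \<partial>M)) \<partial>M)"
    by (subst Bochner_Integration.integral_sum) (simp_all add: emeasure_eq_measure)
  also have "\<dots> = (\<integral>\<omega>. indicat_real A \<omega> * (\<integral>\<omega>'. v (leftover P k (f (X \<omega>)) \<omega>') \<partial>M) \<partial>M)"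
    by (intro Bochner_Integration.integral_cong refl) (rule split[symmetric])
  finally show ?thesis .
qed

text \<open>The two sums collect the losses from suboptimal orders and from suboptimal stopping.\<close>

lemma policy_cost_eq:
  assumes pol: "is_policy P \<pi>"
  shows "policy_cost P \<pi> x = dp_V P 0 x
    + (\<Sum>k<horizon P. exp (- discount P * real k) *
        (\<integral>\<omega>. indicat_real {\<omega> \<in> space M. k < fst \<pi> \<omega>} \<omega> *
          (order_cost P (snd \<pi> k (stock P \<pi> x k \<omega>))
            + dp_G P k (stock P \<pi> x k \<omega> + snd \<pi> k (stock P \<pi> x k \<omega>))
            - dp_V P k (stock P \<pi> x k \<omega>)) \<partial>M))
    + (\<Sum>k\<le>horizon P. exp (- discount P * real k) *
        (\<integral>\<omega>. indicat_real {\<omega> \<in> space M. fst \<pi> \<omega> = k} \<omega> *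
          (scrap_value P (stock P \<pi> x k \<omega>) - dp_V P k (stock P \<pi> x k \<omega>)) \<partial>M))"
proof -
  define d where "d k = exp (- discount P * real k)" for k
  define \<tau> \<mu> X where "\<tau> = fst \<pi>" and "\<mu> = snd \<pi>" and "X = stock P \<pi> x"
  define A where "A k = {\<omega> \<in> space M. k < \<tau> \<omega>}" for k
  define E where "E k = {\<omega> \<in> space M. \<tau> \<omega> = k}" for k
  define r where "r k z = order_cost P (\<mu> k z) + period_cost P k (z + \<mu> k z)" for k z
  \<comment> \<open>\<open>v k\<close> is the discounted value of the current stock and
    \<open>D k\<close> the change of accumulated cost plus this value over one period, so the
    \<open>D k\<close> telescope up to \<open>\<tau>\<close>. The gaps are \<open>g\<close> for
    ordering and \<open>s\<close> for stopping.\<close>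
  define v where "v k \<omega> = d k * dp_V P k (X k \<omega>)" for k \<omega>
  define D where "D k \<omega> = d k * r k (X k \<omega>) + v (Suc k) \<omega> - v k \<omega>" for k \<omega>
  define g where "g k z = order_cost P (\<mu> k z) + dp_G P k (z + \<mu> k z) - dp_V P k z" for k z
  define s where "s k z = scrap_value P z - dp_V P k z" for k z
  have le: "\<tau> \<omega> \<le> horizon P" if "\<omega> \<in> space M" for \<omega>
    using pol that by (simp add: is_policy_def \<tau>_def)
  have hist: "{\<omega> \<in> space M. real (\<tau> \<omega>) \<le> t} \<in> sets (history M (demand P) (real (horizon P)) t)" for t
    using pol by (auto simp: is_policy_def stopping_time_def \<tau>_def pred_def)
  \<comment> \<open>Not having stopped by epoch \<open>k\<close> is known before the demand of the
    next period, so independence applies on \<open>A k\<close>.\<close>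
  have "space M - {\<omega> \<in> space M. real (\<tau> \<omega>) \<le> real k} \<in> sets (hist k)" for k
    using sets.compl_sets[OF hist[of "real k"]] by simp
  moreover have "A k = space M - {\<omega> \<in> space M. real (\<tau> \<omega>) \<le> real k}" for k
    by (auto simp: A_def)
  ultimately have A: "A k \<in> sets (hist k)" for k by simp
  then have [measurable]: "A k \<in> sets M" for k using sets_history_subset by auto
  \<comment> \<open>The subtraction \<open>real k - 1\<close> takes place in the reals: for
    \<open>k = 0\<close> the removed set is empty.\<close>
  have "{\<omega> \<in> space M. real (\<tau> \<omega>) \<le> t} \<in> sets M" for t
    using hist sets_history_subset by auto
  then have "{\<omega> \<in> space M. real (\<tau> \<omega>) \<le> real k} - {\<omega> \<in> space M. real (\<tau> \<omega>) \<le> real k - 1} \<in> sets M" for k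
    by blast
  moreover have "E k = {\<omega> \<in> space M. real (\<tau> \<omega>) \<le> real k} - {\<omega> \<in> space M. real (\<tau> \<omega>) \<le> real k - 1}" for k
    by (auto simp: E_def)
  ultimately have [measurable]: "E k \<in> sets M" for k by simp
  have X: "integrable M (\<lambda>\<omega>. f (X k \<omega>))" if "k \<le> horizon P" for f :: "nat \<Rightarrow> real" and k
    unfolding X_def by (rule stock_integrable[OF that])
  have ind: "integrable M (\<lambda>\<omega>. indicat_real B \<omega> * f \<omega>)"
    if "B \<in> sets M" "integrable M f" for B and f :: "'w \<Rightarrow> real"
    using integrable_mult_indicator[OF that] by simp
  have v: "integrable M (v k)" if "k \<le> horizon P" for k
    unfolding v_def by (rule X[OF that, of "\<lambda>z. d k * dp_V P k z"])
  have D: "integrable M (D k)" if "k < horizon P" for k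
    unfolding D_def[abs_def] using that
    by (intro Bochner_Integration.integrable_add Bochner_Integration.integrable_diff v X) auto

  \<comment> \<open>Indicators turn the random summation range into a fixed one, so that sums and
    expectations can be exchanged.\<close>
  have pointwise: "(\<Sum>k<\<tau> \<omega>. d k * r k (X k \<omega>)) + d (\<tau> \<omega>) * scrap_value P (X (\<tau> \<omega>) \<omega>)
      = dp_V P 0 x + (\<Sum>k<horizon P. indicat_real (A k) \<omega> * D k \<omega>)
        + (\<Sum>k\<le>horizon P. d k * (indicat_real (E k) \<omega> * s k (X k \<omega>)))"
    if \<omega>: "\<omega> \<in> space M" for \<omega>
  proof -
    have "(\<Sum>k<horizon P. indicat_real (A k) \<omega> * D k \<omega>) = (\<Sum>k<\<tau> \<omega>. D k \<omega>)"
      using le[OF \<omega>] \<omega> by (intro sum.mono_neutral_cong_right) (auto simp: A_def indicator_def)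
    also have "\<dots> = (\<Sum>k<\<tau> \<omega>. d k * r k (X k \<omega>)) + (\<Sum>k<\<tau> \<omega>. v (Suc k) \<omega> - v k \<omega>)"
      by (simp add: D_def sum.distrib[symmetric] add_diff_eq)
    also have "(\<Sum>k<\<tau> \<omega>. v (Suc k) \<omega> - v k \<omega>) = v (\<tau> \<omega>) \<omega> - v 0 \<omega>"
      by (rule sum_lessThan_telescope)
    also have "v 0 \<omega> = dp_V P 0 x" by (simp add: v_def d_def X_def)
    finally have 1: "(\<Sum>k<horizon P. indicat_real (A k) \<omega> * D k \<omega>)
        = (\<Sum>k<\<tau> \<omega>. d k * r k (X k \<omega>)) + (v (\<tau> \<omega>) \<omega> - dp_V P 0 x)" .
    have "(\<Sum>k\<le>horizon P. d k * (indicat_real (E k) \<omega> * s k (X k \<omega>)))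
        = (\<Sum>k\<le>horizon P. if k = \<tau> \<omega> then d k * s k (X k \<omega>) else 0)"
      using \<omega> by (intro sum.cong) (auto simp: E_def indicator_def)
    also have "\<dots> = d (\<tau> \<omega>) * scrap_value P (X (\<tau> \<omega>) \<omega>) - v (\<tau> \<omega>) \<omega>"
      using le[OF \<omega>] by (simp add: s_def v_def algebra_simps)
    finally show ?thesis using 1 by simp
  qed

  have step: "(\<integral>\<omega>. indicat_real (A k) \<omega> * D k \<omega> \<partial>M)
      = d k * (\<integral>\<omega>. indicat_real (A k) \<omega> * g k (X k \<omega>) \<partial>M)" if k: "k < horizon P" for k
  proof -
    define w where "w z = (\<integral>\<omega>. dp_V P (Suc k) (leftover P k (z + \<mu> k z) \<omega>) \<partial>M)" for z
    obtain B where "\<And>\<omega>. \<omega> \<in> space M \<Longrightarrow> X k \<omega> \<le> B"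
      using stock_bounded[of k \<pi> x] k unfolding X_def by auto
    from expectation_leftover[OF k A _ this, where v = "dp_V P (Suc k)" and f = "\<lambda>z. z + \<mu> k z"]
    have *: "(\<integral>\<omega>. indicat_real (A k) \<omega> * dp_V P (Suc k) (X (Suc k) \<omega>) \<partial>M)
        = (\<integral>\<omega>. indicat_real (A k) \<omega> * w (X k \<omega>) \<partial>M)"
      using stock_measurable_history[of k \<pi> x] k unfolding w_def X_def \<mu>_def by simp
    \<comment> \<open>The recursion for \<open>dp_G\<close> enters here, with one discount factor
      absorbed into \<open>d (Suc k)\<close>.\<close>
    have g: "d k * g k z = d k * (r k z - dp_V P k z) + d (Suc k) * w z" for z
      unfolding g_def r_def dp_G.simps[of P k "z + \<mu> k z"] w_def d_def
      by (simp add: algebra_simps exp_add[symmetric])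
    have int1: "integrable M (\<lambda>\<omega>. indicat_real (A k) \<omega> * (r k (X k \<omega>) - dp_V P k (X k \<omega>)))"
      and int2: "integrable M (\<lambda>\<omega>. indicat_real (A k) \<omega> * dp_V P (Suc k) (X (Suc k) \<omega>))"
      and int3: "integrable M (\<lambda>\<omega>. indicat_real (A k) \<omega> * w (X k \<omega>))"
      using k by (auto intro!: ind X Bochner_Integration.integrable_diff)
    have "(\<integral>\<omega>. indicat_real (A k) \<omega> * D k \<omega> \<partial>M)
        = (\<integral>\<omega>. d k * (indicat_real (A k) \<omega> * (r k (X k \<omega>) - dp_V P k (X k \<omega>)))
            + d (Suc k) * (indicat_real (A k) \<omega> * dp_V P (Suc k) (X (Suc k) \<omega>)) \<partial>M)"
      by (simp add: D_def v_def algebra_simps)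
    also have "\<dots> = d k * (\<integral>\<omega>. indicat_real (A k) \<omega> * (r k (X k \<omega>) - dp_V P k (X k \<omega>)) \<partial>M)
        + d (Suc k) * (\<integral>\<omega>. indicat_real (A k) \<omega> * w (X k \<omega>) \<partial>M)"
      by (subst Bochner_Integration.integral_add) (use int1 int2 in \<open>simp_all add: *\<close>)
    also have "\<dots> = (\<integral>\<omega>. d k * (indicat_real (A k) \<omega> * (r k (X k \<omega>) - dp_V P k (X k \<omega>)))
        + d (Suc k) * (indicat_real (A k) \<omega> * w (X k \<omega>)) \<partial>M)"
      by (subst Bochner_Integration.integral_add) (use int1 int3 in simp_all)
    also have "\<dots> = (\<integral>\<omega>. indicat_real (A k) \<omega> * (d k * g k (X k \<omega>)) \<partial>M)"
      unfolding g by (simp add: algebra_simps)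
    finally show ?thesis by (simp add: mult.left_commute)
  qed

  have int_A: "integrable M (\<lambda>\<omega>. indicat_real (A k) \<omega> * D k \<omega>)" if "k < horizon P" for k
    using that by (intro ind D) auto
  have int_E: "integrable M (\<lambda>\<omega>. d k * (indicat_real (E k) \<omega> * s k (X k \<omega>)))"
    if "k \<le> horizon P" for k
    using that by (intro integrable_mult_right ind X) auto
  have "policy_cost P \<pi> x = (\<integral>\<omega>. (\<Sum>k<\<tau> \<omega>. d k * r k (X k \<omega>))
      + d (\<tau> \<omega>) * scrap_value P (X (\<tau> \<omega>) \<omega>) \<partial>M)"
    unfolding policy_cost_def d_def r_def \<tau>_def \<mu>_def X_def ..
  also have "\<dots> = (\<integral>\<omega>. dp_V P 0 x + (\<Sum>k<horizon P. indicat_real (A k) \<omega> * D k \<omega>)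
        + (\<Sum>k\<le>horizon P. d k * (indicat_real (E k) \<omega> * s k (X k \<omega>))) \<partial>M)"
    by (intro Bochner_Integration.integral_cong refl pointwise)
  also have "\<dots> = dp_V P 0 x + (\<Sum>k<horizon P. (\<integral>\<omega>. indicat_real (A k) \<omega> * D k \<omega> \<partial>M))
        + (\<Sum>k\<le>horizon P. (\<integral>\<omega>. d k * (indicat_real (E k) \<omega> * s k (X k \<omega>)) \<partial>M))"
    using int_A int_E
    by (subst Bochner_Integration.integral_add
        | subst Bochner_Integration.integral_sum
        | intro Bochner_Integration.integrable_add Bochner_Integration.integrable_sum
        | simp add: prob_space)+
  also have "\<dots> = dp_V P 0 x + (\<Sum>k<horizon P. d k * (\<integral>\<omega>. indicat_real (A k) \<omega> * g k (X k \<omega>) \<partial>M))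
        + (\<Sum>k\<le>horizon P. d k * (\<integral>\<omega>. indicat_real (E k) \<omega> * s k (X k \<omega>) \<partial>M))"
    using step by simp
  finally show ?thesis
    unfolding A_def E_def d_def g_def s_def \<tau>_def \<mu>_def X_def .
qed

section \<open>Optimality of the solution read off from the recursion\<close>

lemma dp_V_le_policy_cost:
  assumes "is_policy P \<pi>"
  shows "dp_V P 0 x \<le> policy_cost P \<pi> x"
proof -
  have *: "dp_V P k z \<le> order_cost P m + dp_G P k (z + m)" if "k < horizon P" for k z m
    using dp_J_le[OF that, of z m] that by (simp add: dp_V.simps[of P k z])
  show ?thesis
    unfolding policy_cost_eq[OF assms]
    by (intro add_increasing2 sum_nonneg mult_nonneg_nonneg integral_nonneg_AE AE_I2)
      (auto simp: dp_V_le_scrap *)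
qed

lemma horizon_in_stopping_set: "x \<in> stopping_set P (horizon P)"
  by (simp add: stopping_set_def)

text \<open>The horizon always belongs to the set under \<open>Min\<close>, so the minimum is a
  genuine one.\<close>

lemma optimal_solution_tau:
  assumes opt: "optimal_solution P x \<pi>" and \<omega>: "\<omega> \<in> space M"
  shows "fst \<pi> \<omega> \<le> horizon P" "stock P \<pi> x (fst \<pi> \<omega>) \<omega> \<in> stopping_set P (fst \<pi> \<omega>)"
    and "k \<le> horizon P \<Longrightarrow> stock P \<pi> x k \<omega> \<in> stopping_set P k \<Longrightarrow> fst \<pi> \<omega> \<le> k"
proof -
  let ?K = "{k. k \<le> horizon P \<and> stock P \<pi> x k \<omega> \<in> stopping_set P k}"
  have eq: "fst \<pi> \<omega> = Min ?K" using opt \<omega> by (simp add: optimal_solution_def)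
  have "finite ?K" by simp
  moreover have "?K \<noteq> {}" using horizon_in_stopping_set by blast
  ultimately have "fst \<pi> \<omega> \<in> ?K" unfolding eq by (rule Min_in)
  then show "fst \<pi> \<omega> \<le> horizon P" "stock P \<pi> x (fst \<pi> \<omega>) \<omega> \<in> stopping_set P (fst \<pi> \<omega>)" by auto
  show "fst \<pi> \<omega> \<le> k" if "k \<le> horizon P" "stock P \<pi> x k \<omega> \<in> stopping_set P k"
    unfolding eq using that by (intro Min_le) auto
qed

lemma optimal_solution_order:
  assumes "optimal_solution P x \<pi>" "k < horizon P"
  shows "order_cost P (snd \<pi> k y) + dp_G P k (y + snd \<pi> k y) = dp_J P k y"
    and "dp_G P k y = dp_J P k y \<Longrightarrow> snd \<pi> k y = 0"
  using assms by (auto simp: optimal_solution_def order_cost_def)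

lemma optimal_solution_is_policy:
  assumes opt: "optimal_solution P x \<pi>"
  shows "is_policy P \<pi>"
proof -
  have "{\<omega> \<in> space M. real (fst \<pi> \<omega>) \<le> t} \<in> sets (history M (demand P) (real (horizon P)) t)" for t
  proof -
    define C where "C k = {\<omega> \<in> space M. stock P \<pi> x k \<omega> \<in> stopping_set P k}" for k
    have C: "C k \<in> sets (history M (demand P) (real (horizon P)) t)"
      if "k \<le> horizon P" "real k \<le> t" for k
    proof -
      have "stock P \<pi> x k -` stopping_set P k \<inter> space (hist k) \<in> sets (hist k)"
        using stock_measurable_history[OF that(1)] by (rule measurable_sets) simp
      then have "C k \<in> sets (hist k)" by (simp add: C_def vimage_def Int_def conj_commute)
      then show ?thesis using history_mono[OF that(2)] by blast
    qed
    \<comment> \<open>Stopping by time \<open>t\<close> means that the stock meets the stopping set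
      at some epoch up to \<open>t\<close>: a finite union of events, each known at its
      epoch.\<close>
    have "{\<omega> \<in> space M. real (fst \<pi> \<omega>) \<le> t} = (\<Union>k\<in>{k. k \<le> horizon P \<and> real k \<le> t}. C k)"
      using optimal_solution_tau[OF opt] by (fastforce simp: C_def)
    then show ?thesis using C by (auto intro!: sets.finite_UN)
  qed
  then show ?thesis
    using optimal_solution_tau(1)[OF opt]
    by (auto simp: is_policy_def stopping_time_def pred_def)
qed

lemma optimal_solution_not_stopped:
  assumes opt: "optimal_solution P x \<pi>" and \<omega>: "\<omega> \<in> space M" and k: "k < fst \<pi> \<omega>"
  shows "k < horizon P" "stock P \<pi> x k \<omega> \<notin> stopping_set P k"
proof -
  show "k < horizon P" using optimal_solution_tau(1)[OF opt \<omega>] k by simp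
  then show "stock P \<pi> x k \<omega> \<notin> stopping_set P k"
    using optimal_solution_tau(3)[OF opt \<omega>, of k] k by fastforce
qed

text \<open>Each gap vanishes on its own event: before stopping, the state is outside the stopping
  set and \<open>dp_V\<close> equals \<open>dp_J\<close>, which the order attains; at the stopping
  epoch \<open>dp_V\<close> is the scrap value.\<close>

lemma optimal_solution_cost:
  assumes opt: "optimal_solution P x \<pi>"
  shows "policy_cost P \<pi> x = dp_V P 0 x"
proof -
  let ?X = "stock P \<pi> x"
  have "order_cost P (snd \<pi> k (?X k \<omega>)) + dp_G P k (?X k \<omega> + snd \<pi> k (?X k \<omega>)) - dp_V P k (?X k \<omega>) = 0"
    if "\<omega> \<in> space M" "k < fst \<pi> \<omega>" for k \<omega>
    using optimal_solution_not_stopped[OF opt that] optimal_solution_order(1)[OF opt]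
    by (simp add: stopping_set_iff dp_V.simps[of P k "?X k \<omega>"])
  then have "(\<integral>\<omega>. indicat_real {\<omega> \<in> space M. k < fst \<pi> \<omega>} \<omega> *
      (order_cost P (snd \<pi> k (?X k \<omega>)) + dp_G P k (?X k \<omega> + snd \<pi> k (?X k \<omega>))
        - dp_V P k (?X k \<omega>)) \<partial>M) = 0" for k
    by (intro integral_eq_zero_AE AE_I2) (auto simp: indicator_def)
  moreover have "scrap_value P (?X k \<omega>) - dp_V P k (?X k \<omega>) = 0"
    if "\<omega> \<in> space M" "fst \<pi> \<omega> = k" for k \<omega>
    using optimal_solution_tau(2)[OF opt that(1)] that(2)
    by (simp add: stopping_set_iff dp_V.simps[of P k "?X k \<omega>"])
  then have "(\<integral>\<omega>. indicat_real {\<omega> \<in> space M. fst \<pi> \<omega> = k} \<omega> *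
      (scrap_value P (?X k \<omega>) - dp_V P k (?X k \<omega>)) \<partial>M) = 0" for k
    by (intro integral_eq_zero_AE AE_I2) (auto simp: indicator_def)
  ultimately show ?thesis
    unfolding policy_cost_eq[OF optimal_solution_is_policy[OF opt]] by simp
qed

lemma optimal_solution_attains:
  assumes opt: "optimal_solution P x \<pi>"
  shows "ereal (policy_cost P \<pi> x) = optimal_value P x"
  unfolding optimal_value_def
proof (rule antisym)
  show "ereal (policy_cost P \<pi> x) \<le> (INF \<pi>\<in>{\<pi>. is_policy P \<pi>}. ereal (policy_cost P \<pi> x))"
    unfolding optimal_solution_cost[OF opt] by (intro INF_greatest) (auto intro: dp_V_le_policy_cost)
  show "(INF \<pi>\<in>{\<pi>. is_policy P \<pi>}. ereal (policy_cost P \<pi> x)) \<le> ereal (policy_cost P \<pi> x)"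
    using optimal_solution_is_policy[OF opt] by (intro INF_lower) auto
qed

lemma optimal_solution_exists: "\<exists>\<pi>. optimal_solution P x \<pi>"
proof -
  \<comment> \<open>The bound on \<open>k\<close> sits under the quantifier so that choice yields a
    total function \<open>\<mu>\<close>.\<close>
  have "\<exists>m. k < horizon P \<longrightarrow> order_cost P m + dp_G P k (y + m) = dp_J P k y
      \<and> (order_cost P 0 + dp_G P k y = dp_J P k y \<longrightarrow> m = 0)" for k y
  proof (cases "order_cost P 0 + dp_G P k y = dp_J P k y")
    case True
    then show ?thesis by (intro exI[of _ 0]) simp
  next
    case False
    then show ?thesis using dp_J_attained(2)[of k y] by blast
  qed
  then obtain \<mu> where \<mu>: "\<And>k y. k < horizon P \<Longrightarrow> order_cost P (\<mu> k y) + dp_G P k (y + \<mu> k y) = dp_J P k y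
      \<and> (order_cost P 0 + dp_G P k y = dp_J P k y \<longrightarrow> \<mu> k y = 0)"
    by metis
  \<comment> \<open>\<open>undefined\<close> fills the slot of the stopping time, which does not
    influence the stock.\<close>
  define \<tau> where "\<tau> \<omega> = Min {k. k \<le> horizon P \<and> stock P (undefined, \<mu>) x k \<omega> \<in> stopping_set P k}" for \<omega>
  have "stock P (\<tau>, \<mu>) x k \<omega> = stock P (undefined, \<mu>) x k \<omega>" for k \<omega>
    by (rule stock_cong) simp
  then have "optimal_solution P x (\<tau>, \<mu>)"
    unfolding optimal_solution_def using \<mu> by (simp add: \<tau>_def)
  then show ?thesis ..
qed

lemma optimal_solution_actions:
  assumes opt: "optimal_solution P x \<pi>" and \<omega>: "\<omega> \<in> space M" and k: "k \<le> fst \<pi> \<omega>"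
  shows "stock P \<pi> x k \<omega> \<in> stopping_set P k \<Longrightarrow> fst \<pi> \<omega> = k"
    and "stock P \<pi> x k \<omega> \<in> continuation_set P k \<Longrightarrow>
      k < fst \<pi> \<omega> \<and> snd \<pi> k (stock P \<pi> x k \<omega>) = 0"
    and "stock P \<pi> x k \<omega> \<in> ordering_set P k \<Longrightarrow>
      k < fst \<pi> \<omega> \<and> optimal_order_up_to_level P k (stock P \<pi> x k \<omega>)
        (stock P \<pi> x k \<omega> + snd \<pi> k (stock P \<pi> x k \<omega>))"
proof -
  let ?X = "stock P \<pi> x k \<omega>"
  note \<tau> = optimal_solution_tau[OF opt \<omega>]
  show "fst \<pi> \<omega> = k" if "?X \<in> stopping_set P k"
    using \<tau>(1) \<tau>(3)[of k] that k by simp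
  have less: "k < fst \<pi> \<omega>" if "?X \<notin> stopping_set P k"
    using \<tau>(2) that k by (cases "fst \<pi> \<omega> = k") auto
  show "k < fst \<pi> \<omega> \<and> snd \<pi> k ?X = 0" if "?X \<in> continuation_set P k"
    using that less optimal_solution_order(2)[OF opt, of k ?X]
    by (auto simp: continuation_set_iff stopping_set_iff)
  show "k < fst \<pi> \<omega> \<and> optimal_order_up_to_level P k ?X (?X + snd \<pi> k ?X)"
    if X: "?X \<in> ordering_set P k"
  proof -
    have J: "order_cost P (snd \<pi> k ?X) + dp_G P k (?X + snd \<pi> k ?X) = dp_J P k ?X"
      using X optimal_solution_order(1)[OF opt, of k ?X] by (simp add: ordering_set_iff)
    \<comment> \<open>A zero order would make \<open>dp_J\<close> equal to \<open>dp_G\<close>,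
      which the ordering set excludes.\<close>
    then have "snd \<pi> k ?X \<noteq> 0"
      using X by (intro notI) (simp add: ordering_set_iff order_cost_def)
    then show ?thesis
      using X J less by (auto simp: ordering_set_iff stopping_set_iff optimal_order_up_to_level_def)
  qed
qed

section \<open>Order-up-to levels and the partition into regions\<close>

lemma ordering_set_order_up_to:
  assumes x: "x \<in> ordering_set P k"
  shows "\<exists>y. optimal_order_up_to_level P k x y"
proof -
  obtain m where m: "order_cost P m + dp_G P k (x + m) = dp_J P k x"
    using dp_J_attained(2)[of k x] x by (auto simp: ordering_set_iff)
  then have "m \<noteq> 0" using x by (intro notI) (simp add: ordering_set_iff order_cost_def)
  then have "optimal_order_up_to_level P k x (x + m)"
    using m by (simp add: optimal_order_up_to_level_def)
  then show ?thesis ..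
qed

text \<open>Outside the stopping set \<open>dp_J\<close> is below the scrap value, and
  \<open>dp_J \<le> dp_G\<close> is either strict (order) or an equality (continue). At the horizon
  every state is stopping.\<close>

lemma regions_cover:
  "ordering_region P \<union> stopping_region P \<union> continuation_region P = {..horizon P} \<times> UNIV"
proof -
  have "x \<in> ordering_set P k \<or> x \<in> stopping_set P k \<or> x \<in> continuation_set P k" for k x
    using dp_J_le[of k x 0]
    by (auto simp: ordering_set_iff stopping_set_iff continuation_set_iff order_cost_def)
  then show ?thesis
    by (auto simp: ordering_region_def stopping_region_def continuation_region_def)
qed

lemma regions_disjoint:
  "ordering_region P \<inter> stopping_region P = {}"
  "ordering_region P \<inter> continuation_region P = {}"
  "stopping_region P \<inter> continuation_region P = {}"
  by (auto simp: ordering_region_def stopping_region_def continuation_region_def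
      ordering_set_iff stopping_set_iff continuation_set_iff)

end

theorem proposition3p4:
  fixes P :: "'w inventory"
  assumes "inventory_problem P"
  shows
    "ordering_region P \<union> stopping_region P \<union> continuation_region P = {..horizon P} \<times> UNIV
     \<and> ordering_region P \<inter> stopping_region P = {}
     \<and> ordering_region P \<inter> continuation_region P = {}
     \<and> stopping_region P \<inter> continuation_region P = {}
     \<and> (\<forall>x. (\<exists>\<pi>. optimal_solution P x \<pi>)
          \<and> (\<forall>\<pi>. optimal_solution P x \<pi> \<longrightarrow>
               is_policy P \<pi> \<and> ereal (policy_cost P \<pi> x) = optimal_value P x
               \<and> (\<forall>\<omega>\<in>space (prob_model P). \<forall>k\<le>fst \<pi> \<omega>.
                    let X = stock P \<pi> x k \<omega>; m = snd \<pi> k X in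
                      (X \<in> stopping_set P k \<longrightarrow> fst \<pi> \<omega> = k)
                      \<and> (X \<in> continuation_set P k \<longrightarrow> k < fst \<pi> \<omega> \<and> m = 0)
                      \<and> (X \<in> ordering_set P k \<longrightarrow>
                           k < fst \<pi> \<omega> \<and> optimal_order_up_to_level P k X (X + m)))))
     \<and> (\<forall>k\<le>horizon P. \<forall>x\<in>ordering_set P k. \<exists>y. optimal_order_up_to_level P k x y)"
  using regions_cover[OF assms] regions_disjoint[OF assms] optimal_solution_exists[OF assms]
    optimal_solution_is_policy[OF assms] optimal_solution_attains[OF assms]
    ordering_set_order_up_to[OF assms]
  unfolding Let_def
  by (intro conjI allI impI ballI; (simp; fail)?) (blast dest: optimal_solution_actions[OF assms])+

end
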